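(* Let $\Sigma$ be an $n\times n$ real symmetric positive-definite matrix, $X$ an $n\times p$ real matrix of full column rank, $\mathcal X=\operatorname{im}(X)$, and $$M=\Sigma^{-1}-\Sigma^{-1}X(X^{*}\Sigma^{-1}X)^{-1}X^{*}\Sigma^{-1}.$$ Let $y\in\mathbb R^n$ have the (possibly improper) density $p(y)\propto\exp(-\tfrac12\,y^{*}My)$, so that $M$ is its precision matrix. Let $n=n_1+n_2$, partition $y$ into its first $n_1$ coordinates $y_1\in\mathbb R^{n_1}$ and its last $n_2$ coordinates $y_2\in\mathbb R^{n_2}$, and partition $M$ correspondingly as $$M=\begin{bmatrix}M_{11}&M_{12}\\ M_{12}^{*}&M_{22}\end{bmatrix}.$$ Let $\mathcal Y_1=\operatorname{span}(e_1,\dots,e_{n_1})$, where $e_i$ is the unit vector along the $i$-th axis. If $\mathcal Y_1\cap\mathcal X=\{0\}$, then the distribution of $y_1$ given $y_2$ is the normal distribution $$y_1\mid y_2\sim\mathcal N^{-1}(\eta_{1|2},M_{1|2}),\qquad \eta_{1|2}=-M_{12}y_2,\quad M_{1|2}=M_{11},$$ and the marginal distribution of $y_2$ is $$y_2\sim\mathcal N^{-1}(0,M_{22}'),\qquad M_{22}'=M_{22}-M_{12}^{*}M_{11}^{\dagger}M_{12}.$$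
   Context: $(\cdot)^{*}$ is the transpose and $(\cdot)^{\dagger}$ the Moore-Penrose pseudo-inverse. The function $p$ is the likelihood of a Gaussian process regression with covariance $\Sigma$ and design matrix $X$; it is constant along $\mathcal X=\ker(M)$, hence in general an improper density on $\mathbb R^n$, defined up to a positive constant. The precision matrix of $p$ is by definition $M$, which equals the Bott-Duffin inverse of $\Sigma$ on $\mathcal X^{\perp}$. $\mathcal N^{-1}(\eta,Q)$ is the canonical (information) parametrization: for symmetric positive-definite $Q$ it is the normal distribution with precision matrix $Q$ (covariance $Q^{-1}$) and potential vector $\eta=Q\mu$, where $\mu$ is the mean; for symmetric positive-semidefinite $Q$ and $\eta=0$ it denotes the (possibly improper) density proportional to $z\mapsto\exp(-\tfrac12 z^{*}Qz)$. The conditional density of $y_1$ given $y_2$ is $p$ viewed as a function of $y_1$ for fixed $y_2$, normalized; the marginal density of $y_2$ is obtained by integrating $p$ over $y_1\in\mathbb R^{n_1}$, up to a positive constant. *)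

theory Defs
  imports "HOL-Analysis.Analysis"
begin

definition pos_def :: "real^'n^'n \<Rightarrow> bool" where
  "pos_def A \<longleftrightarrow> transpose A = A \<and> (\<forall>x. x \<noteq> 0 \<longrightarrow> x \<bullet> (A *v x) > 0)"

definition pos_semidef :: "real^'n^'n \<Rightarrow> bool" where
  "pos_semidef A \<longleftrightarrow> transpose A = A \<and> (\<forall>x. x \<bullet> (A *v x) \<ge> 0)"

definition is_pseudo_inverse :: "real^'n^'m \<Rightarrow> real^'m^'n \<Rightarrow> bool" where
  "is_pseudo_inverse A B \<longleftrightarrow>
     A ** B ** A = A \<and> B ** A ** B = B \<and>
     transpose (A ** B) = A ** B \<and> transpose (B ** A) = B ** A"

definition pseudo_inverse :: "real^'n^'m \<Rightarrow> real^'m^'n" where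
  "pseudo_inverse A = (THE B. is_pseudo_inverse A B)"

text \<open>
  A coordinate space of dimension n = n1 + n2 is indexed by the sum of the two index types:
  Inl indexes the first n1 coordinates and Inr the last n2 coordinates.
\<close>

definition join_vec :: "real^'a \<Rightarrow> real^'b \<Rightarrow> real^('a::finite + 'b::finite)" where
  "join_vec u v = (\<chi> k. case k of Inl i \<Rightarrow> u $ i | Inr j \<Rightarrow> v $ j)"

definition block11 :: "real^('a::finite + 'b::finite)^('a + 'b) \<Rightarrow> real^'a^'a" where
  "block11 A = (\<chi> i j. A $ Inl i $ Inl j)"

definition block12 :: "real^('a::finite + 'b::finite)^('a + 'b) \<Rightarrow> real^'b^'a" where
  "block12 A = (\<chi> i j. A $ Inl i $ Inr j)"

definition block22 :: "real^('a::finite + 'b::finite)^('a + 'b) \<Rightarrow> real^'b^'b" where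
  "block22 A = (\<chi> i j. A $ Inr i $ Inr j)"

definition proportional :: "('a \<Rightarrow> real) \<Rightarrow> ('a \<Rightarrow> real) \<Rightarrow> bool" where
  "proportional f g \<longleftrightarrow> (\<exists>c>0. \<forall>x. f x = c * g x)"

text \<open>
  A Bochner integral of a non-integrable function is 0. Hence both definitions below return 0
  at any point where the integral diverges, which cannot agree with a positive density.
\<close>

definition marginal_density :: "(real^('a::finite + 'b::finite) \<Rightarrow> real) \<Rightarrow> real^'b \<Rightarrow> real" where
  "marginal_density f v = (LINT u|lborel. f (join_vec u v))"

definition conditional_density :: "(real^('a::finite + 'b::finite) \<Rightarrow> real) \<Rightarrow> real^'b \<Rightarrow> real^'a \<Rightarrow> real" where
  "conditional_density f v u = f (join_vec u v) / (LINT t|lborel. f (join_vec t v))"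

definition mvn_density :: "real^'n \<Rightarrow> real^'n^'n \<Rightarrow> real^'n \<Rightarrow> real" where
  "mvn_density \<mu> C z =
     exp (- (1/2) * ((z - \<mu>) \<bullet> (matrix_inv C *v (z - \<mu>)))) / sqrt ((2 * pi) ^ CARD('n) * det C)"

text \<open>
  The two readings of the canonical parametrization: a proper normal distribution for positive
  definite precision matrix, and a possibly improper density, known only up to a positive
  constant, for positive semidefinite precision matrix and zero potential vector.
\<close>

definition normal_canonical :: "(real^'n \<Rightarrow> real) \<Rightarrow> real^'n \<Rightarrow> real^'n^'n \<Rightarrow> bool" where
  "normal_canonical f \<eta> Q \<longleftrightarrow>
     pos_def Q \<and> (\<exists>\<mu>. \<eta> = Q *v \<mu> \<and> f = mvn_density \<mu> (matrix_inv Q))"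

definition improper_normal_canonical :: "(real^'n \<Rightarrow> real) \<Rightarrow> real^'n \<Rightarrow> real^'n^'n \<Rightarrow> bool" where
  "improper_normal_canonical f \<eta> Q \<longleftrightarrow>
     pos_semidef Q \<and> \<eta> = 0 \<and> proportional f (\<lambda>z. exp (- (1/2) * (z \<bullet> (Q *v z))))"

end

(* The form y* M y is the squared Sigma^(-1)-norm of the generalized least squares residual of y,
   so it vanishes only on im(X). As im(X) meets Y_1 trivially, M_11 is positive definite, and
   completing the square in y_1 splits the density into a proper Gaussian factor in y_1 with mean
   - M_11^(-1) M_12 y_2, whose integral does not depend on y_2, times a factor in y_2 whose form is
   the Schur complement of M_11. The normalizing constant comes from a Q-orthonormal basis V
   (V* Q V = 1), which turns the Gaussian integral of Q into a product of one-dimensional ones. *)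
theory Submission
  imports Defs "HOL-Probability.Distributions"
begin

subsection \<open>Positive definite matrices\<close>

lemma matrix_inv_invertible:
  assumes "invertible A"
  shows "A ** matrix_inv A = mat 1" "matrix_inv A ** A = mat 1"
proof -
  have "A ** matrix_inv A = mat 1 \<and> matrix_inv A ** A = mat 1"
    using assms unfolding invertible_def matrix_inv_def by (rule someI_ex)
  then show "A ** matrix_inv A = mat 1" "matrix_inv A ** A = mat 1" by auto
qed

lemma matrix_inv_unique_right:
  fixes A B :: "real^'n^'n"
  assumes "A ** B = mat 1"
  shows "matrix_inv A = B"
proof -
  have "invertible A"
    using assms matrix_left_right_inverse unfolding invertible_def by blast
  then have "matrix_inv A ** (A ** B) = B"
    by (simp add: matrix_mul_assoc matrix_inv_invertible)
  then show ?thesis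
    by (simp add: assms)
qed

lemma inner_matrix_transpose:
  fixes A :: "real^'n^'m"
  shows "x \<bullet> (A *v y) = (transpose A *v x) \<bullet> y"
  by (simp add: dot_lmul_matrix)

lemma pos_def_invertible:
  assumes "pos_def A"
  shows "invertible A"
proof -
  have "x = 0" if "A *v x = 0" for x
    using assms that unfolding pos_def_def by (metis inner_zero_right less_irrefl)
  then show ?thesis
    by (metis invertible_left_inverse matrix_left_invertible_ker)
qed

lemma transpose_matrix_inv_symmetric:
  fixes A :: "real^'n^'n"
  assumes "invertible A" "transpose A = A"
  shows "transpose (matrix_inv A) = matrix_inv A"
proof -
  have "A ** transpose (matrix_inv A) = mat 1"
    by (metis assms matrix_inv_invertible(2) matrix_transpose_mul transpose_mat)
  then show ?thesis
    using matrix_inv_unique_right by metis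
qed

text \<open>Substituting \<open>x = A *v w\<close> turns the form of the inverse at \<open>x\<close>
  into the form of \<open>A\<close> at \<open>w\<close>.\<close>

lemma pos_def_matrix_inv:
  assumes "pos_def A"
  shows "pos_def (matrix_inv A)"
  unfolding pos_def_def
proof (intro conjI allI impI)
  note inv = pos_def_invertible[OF assms]
  show "transpose (matrix_inv A) = matrix_inv A"
    using transpose_matrix_inv_symmetric[OF inv] assms by (simp add: pos_def_def)
  fix x :: "real^'a" assume "x \<noteq> 0"
  define w where "w = matrix_inv A *v x"
  have x: "x = A *v w"
    by (simp add: w_def matrix_vector_mul_assoc matrix_inv_invertible[OF inv])
  then have "w \<noteq> 0" using \<open>x \<noteq> 0\<close> by auto
  then have "0 < w \<bullet> (A *v w)" using assms by (simp add: pos_def_def)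
  then show "0 < x \<bullet> (matrix_inv A *v x)"
    by (simp only: x[symmetric] w_def[symmetric] inner_commute)
qed

text \<open>Injectivity keeps \<open>X *v b\<close> away from zero. With \<open>S\<close> the
  inverse of \<open>\<Sigma>\<close>, this makes the matrix of the normal equations
  invertible.\<close>

lemma pos_def_congruence:
  fixes X :: "real^'p^'n"
  assumes "pos_def S" "inj ((*v) X)"
  shows "pos_def (transpose X ** S ** X)"
  unfolding pos_def_def
proof (intro conjI allI impI)
  show "transpose (transpose X ** S ** X) = transpose X ** S ** X"
    using assms(1) by (simp add: pos_def_def matrix_transpose_mul matrix_mul_assoc)
  fix b :: "real^'p" assume "b \<noteq> 0"
  then have "X *v b \<noteq> 0"
    using assms(2) by (metis injD matrix_vector_mult_0_right)
  then have "0 < (X *v b) \<bullet> (S *v (X *v b))"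
    using assms(1) by (simp add: pos_def_def)
  also have "\<dots> = b \<bullet> ((transpose X ** S ** X) *v b)"
    using inner_matrix_transpose[of b "transpose X" "S *v (X *v b)"]
    by (simp only: matrix_vector_mul_assoc matrix_mul_assoc transpose_transpose)
  finally show "0 < b \<bullet> ((transpose X ** S ** X) *v b)" .
qed

text \<open>Cancelling \<open>A\<close> on the right of the first Penrose equation forces
  \<open>A ** B = mat 1\<close>. The Schur complement can then be formed with the ordinary inverse
  of \<open>M11\<close>.\<close>

lemma pseudo_inverse_invertible:
  fixes A :: "real^'n^'n"
  assumes "invertible A"
  shows "pseudo_inverse A = matrix_inv A"
  unfolding pseudo_inverse_def
proof (rule the_equality)
  show "is_pseudo_inverse A (matrix_inv A)"
    by (simp add: is_pseudo_inverse_def matrix_inv_invertible[OF assms])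
  fix B assume "is_pseudo_inverse A B"
  then have "A ** B ** A ** matrix_inv A = A ** matrix_inv A"
    by (simp add: is_pseudo_inverse_def)
  then have "A ** B = mat 1"
    by (simp add: matrix_mul_assoc[symmetric] matrix_inv_invertible[OF assms])
  then show "B = matrix_inv A"
    by (simp add: matrix_inv_unique_right)
qed

text \<open>Gram-Schmidt for the inner product given by \<open>Q\<close>, by induction on the index
  set. Each new direction comes from a dimension count instead of an explicit projection.\<close>

lemma pos_def_orthonormal_family:
  fixes Q :: "real^'n^'n"
  assumes Q: "pos_def Q" and "finite K"
  shows "\<exists>v::'n \<Rightarrow> real^'n. \<forall>i\<in>K. \<forall>j\<in>K. v i \<bullet> (Q *v v j) = of_bool (i = j)"
  using \<open>finite K\<close>
proof induction
  case (insert k K)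
  then obtain v :: "'n \<Rightarrow> real^'n"
    where v: "\<And>i j. i \<in> K \<Longrightarrow> j \<in> K \<Longrightarrow> v i \<bullet> (Q *v v j) = of_bool (i = j)"
    by blast
  \<comment> \<open>Since \<open>k\<close> is a fresh index, the vectors \<open>Q *v v i\<close>
    span a proper subspace, so some nonzero \<open>x\<close> is orthogonal to all of them. Euclidean
    orthogonality to \<open>Q *v v i\<close> is \<open>Q\<close>-orthogonality to
    \<open>v i\<close>.\<close>
  have "dim ((\<lambda>i. Q *v v i) ` K) \<le> card K"
    using dim_le_card[of "(\<lambda>i. Q *v v i) ` K"] card_image_le[OF insert.hyps(1)]
    by (meson dim_le_card' finite_imageI insert.hyps(1) le_trans)
  also have "card K < card (insert k K)"
    using insert.hyps by simp
  also have "card (insert k K) \<le> DIM(real^'n)"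
    by (simp add: card_mono)
  finally obtain x where "x \<noteq> 0"
    and x: "\<And>y. y \<in> span ((\<lambda>i. Q *v v i) ` K) \<Longrightarrow> orthogonal x y"
    using orthogonal_to_subspace_exists by blast
  have pos: "0 < x \<bullet> (Q *v x)"
    using Q \<open>x \<noteq> 0\<close> by (simp add: pos_def_def)
  have sym: "a \<bullet> (Q *v b) = b \<bullet> (Q *v a)" for a b
    using Q inner_matrix_transpose[of a Q b] by (simp add: pos_def_def inner_commute)
  have orth: "x \<bullet> (Q *v v i) = 0" if "i \<in> K" for i
    using x[of "Q *v v i"] that by (auto simp: orthogonal_def span_base)
  \<comment> \<open>The new vector is \<open>x\<close> scaled to \<open>Q\<close>-length
    one.\<close>
  define w where "w = v(k := (1 / sqrt (x \<bullet> (Q *v x))) *\<^sub>R x)"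
  have "w i \<bullet> (Q *v w j) = of_bool (i = j)" if "i \<in> insert k K" "j \<in> insert k K" for i j
    using that insert.hyps(2) v orth sym[of "v i" x] pos
    by (auto simp: w_def matrix_vector_mult_scaleR power2_eq_square[symmetric])
  then show ?case by blast
qed auto

text \<open>The columns of \<open>V\<close> form a \<open>Q\<close>-orthonormal basis, and the
  entries of the product are their mutual \<open>Q\<close>-inner products.\<close>

lemma pos_def_diagonalization:
  fixes Q :: "real^'n^'n"
  assumes "pos_def Q"
  obtains V :: "real^'n^'n" where "transpose V ** Q ** V = mat 1"
proof -
  obtain v :: "'n \<Rightarrow> real^'n" where v: "\<And>i j. v i \<bullet> (Q *v v j) = of_bool (i = j)"
    using pos_def_orthonormal_family[OF assms, of UNIV] by auto
  define V :: "real^'n^'n" where "V = (\<chi> i j. v j $ i)"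
  have col: "V *v axis j 1 = v j" for j
    by (simp add: V_def matrix_vector_mult_def axis_def vec_eq_iff if_distrib cong: if_cong)
  have "(transpose V ** Q ** V) $ i $ j = mat 1 $ i $ j" for i j
  proof -
    have "(transpose V ** Q ** V) $ i $ j = axis i 1 \<bullet> ((transpose V ** Q ** V) *v axis j 1)"
      by (simp add: inner_axis' matrix_vector_mult_basis column_def)
    also have "\<dots> = v i \<bullet> (Q *v v j)"
      using inner_matrix_transpose[of "axis i 1" "transpose V" "Q *v (V *v axis j 1)"]
      by (simp only: matrix_vector_mul_assoc[symmetric] transpose_transpose col)
    finally show ?thesis by (simp add: v mat_def)
  qed
  then show ?thesis
    using that[of V] by (simp add: vec_eq_iff)
qed

subsection \<open>Block decomposition of quadratic forms\<close>

lemma sum_UNIV_Plus: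
  "sum f (UNIV :: ('a::finite + 'b::finite) set) = (\<Sum>i\<in>UNIV. f (Inl i)) + (\<Sum>j\<in>UNIV. f (Inr j))"
  unfolding UNIV_Plus_UNIV[symmetric] by (subst sum.Plus) simp_all

lemma inner_join_vec: "join_vec a b \<bullet> join_vec c d = a \<bullet> c + b \<bullet> d"
  by (simp add: inner_vec_def sum_UNIV_Plus join_vec_def)

lemma matrix_vector_mult_join_vec:
  fixes M :: "real^('a::finite + 'b::finite)^('a + 'b)"
  assumes "transpose M = M"
  shows "M *v join_vec u v =
    join_vec (block11 M *v u + block12 M *v v) (transpose (block12 M) *v u + block22 M *v v)"
proof -
  have "M $ Inr j $ Inl i = M $ Inl i $ Inr j" for i j
    using arg_cong[OF assms, of "\<lambda>A. A $ Inr j $ Inl i"] by (simp add: transpose_def)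
  then show ?thesis
    by (auto simp: vec_eq_iff matrix_vector_mult_def sum_UNIV_Plus join_vec_def block11_def
        block12_def block22_def transpose_def split: sum.split)
qed

text \<open>With \<open>Q\<close> the first block and \<open>w = R *v (B *v v)\<close>, one has
  \<open>Q *v w = B *v v\<close>. Both cross terms of the square are therefore
  \<open>u \<bullet> (B *v v)\<close>, and the surplus \<open>w \<bullet> (B *v v)\<close> is what
  the Schur complement subtracts.\<close>

lemma quadratic_form_complete_square:
  fixes M :: "real^('a::finite + 'b::finite)^('a + 'b)"
  assumes sym: "transpose M = M" and pd: "pos_def (block11 M)"
  defines "B \<equiv> block12 M" and "R \<equiv> matrix_inv (block11 M)"
  shows "join_vec u v \<bullet> (M *v join_vec u v) =
    (u + R *v (B *v v)) \<bullet> (block11 M *v (u + R *v (B *v v))) +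
    v \<bullet> ((block22 M - transpose B ** R ** B) *v v)"
proof -
  let ?Q = "block11 M" and ?w = "R *v (B *v v)"
  have Qw: "?Q *v ?w = B *v v"
    by (simp add: R_def matrix_vector_mul_assoc matrix_mul_assoc matrix_inv_invertible
        pos_def_invertible pd)
  have 1: "v \<bullet> (transpose B *v u) = u \<bullet> (B *v v)" for u
    using inner_matrix_transpose[of u B v] by (simp only: inner_commute)
  have 2: "?w \<bullet> (?Q *v u) = u \<bullet> (B *v v)"
    using inner_matrix_transpose[of ?w ?Q u] pd Qw by (simp only: inner_commute pos_def_def)
  have 3: "v \<bullet> ((transpose B ** R ** B) *v v) = ?w \<bullet> (B *v v)"
    using 1[of ?w] by (simp only: matrix_vector_mul_assoc[symmetric])
  show ?thesis
    unfolding matrix_vector_mult_join_vec[OF sym] inner_join_vec matrix_vector_right_distrib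
      inner_add_left inner_add_right matrix_vector_mult_diff_rdistrib inner_diff_right Qw 2 3
    using 1[of u] by (simp add: B_def)
qed

subsection \<open>The precision matrix of generalized least squares\<close>

text \<open>Generalized least squares over an arbitrary index type, before any block split; full
  column rank is phrased as injectivity of \<open>X\<close>.\<close>

locale gls_precision =
  fixes \<Sigma> M :: "real^'n^'n" and X :: "real^'p^'n"
  assumes pd: "pos_def \<Sigma>" and inj: "inj ((*v) X)"
    and M: "M = matrix_inv \<Sigma> - matrix_inv \<Sigma> ** X **
               matrix_inv (transpose X ** matrix_inv \<Sigma> ** X) ** transpose X ** matrix_inv \<Sigma>"
begin

lemma symmetric: "transpose M = M"
proof -
  have S: "transpose (matrix_inv \<Sigma>) = matrix_inv \<Sigma>"
    using pos_def_matrix_inv[OF pd] by (simp add: pos_def_def)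
  let ?A = "transpose X ** matrix_inv \<Sigma> ** X"
  have A: "transpose (matrix_inv ?A) = matrix_inv ?A"
    using pos_def_matrix_inv[OF pos_def_congruence[OF pos_def_matrix_inv[OF pd] inj]]
    by (simp add: pos_def_def)
  have "transpose (P - P') = transpose P - transpose P'" for P P' :: "real^'n^'n"
    by (simp add: transpose_def vec_eq_iff)
  then show ?thesis
    unfolding M by (simp add: matrix_transpose_mul S A matrix_mul_assoc)
qed

text \<open>The residual of the fit is orthogonal to im(X) in the inner product of the inverse of
  \<open>\<Sigma>\<close>, and \<open>M *v y\<close> is that inverse applied to the residual.
  Replacing \<open>y\<close> by its residual on the left therefore leaves the form
  unchanged.\<close>

lemma quadratic_form_residual:
  obtains b where "y \<bullet> (M *v y) = (y - X *v b) \<bullet> (matrix_inv \<Sigma> *v (y - X *v b))"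
proof -
  let ?S = "matrix_inv \<Sigma>"
  let ?A = "transpose X ** ?S ** X"
  \<comment> \<open>The generalized least squares coefficients, that is, the solution of the normal
    equations for \<open>y\<close>.\<close>
  define b where "b = matrix_inv ?A *v (transpose X *v (?S *v y))"
  let ?z = "y - X *v b"
  have "?A *v b = transpose X *v (?S *v y)"
    using pos_def_invertible[OF pos_def_congruence[OF pos_def_matrix_inv[OF pd] inj]]
    by (simp only: b_def matrix_vector_mul_assoc[of ?A] matrix_inv_invertible matrix_vector_mul_lid)
  then have "transpose X *v (?S *v ?z) = 0"
    by (simp only: matrix_vector_mult_diff_distrib matrix_vector_mul_assoc[symmetric]) simp
  then have "(X *v b) \<bullet> (?S *v ?z) = 0"
    using inner_matrix_transpose[of "?S *v ?z" X b] by (simp only: inner_commute inner_zero_left)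
  moreover have "M *v y = ?S *v ?z"
    unfolding M b_def
    by (simp only: matrix_vector_mult_diff_rdistrib matrix_vector_mult_diff_distrib
        matrix_vector_mul_assoc[symmetric])
  ultimately have "y \<bullet> (M *v y) = ?z \<bullet> (?S *v ?z)"
    by (simp only: inner_diff_left diff_zero)
  then show ?thesis
    by (rule that)
qed

lemma quadratic_form_nonneg: "0 \<le> y \<bullet> (M *v y)"
proof -
  obtain b where "y \<bullet> (M *v y) = (y - X *v b) \<bullet> (matrix_inv \<Sigma> *v (y - X *v b))"
    by (rule quadratic_form_residual)
  then show ?thesis
    using pos_def_matrix_inv[OF pd] unfolding pos_def_def
    by (cases "y - X *v b = 0") (auto simp: less_imp_le)
qed

text \<open>Outside im(X) the residual is nonzero whatever the coefficients \<open>b\<close>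
  are.\<close>

lemma quadratic_form_pos:
  assumes "y \<notin> range ((*v) X)"
  shows "0 < y \<bullet> (M *v y)"
proof -
  obtain b where b: "y \<bullet> (M *v y) = (y - X *v b) \<bullet> (matrix_inv \<Sigma> *v (y - X *v b))"
    by (rule quadratic_form_residual)
  have "y - X *v b \<noteq> 0"
    using assms by auto
  with b show ?thesis
    using pos_def_matrix_inv[OF pd] unfolding pos_def_def by simp
qed

end

lemma pos_def_block11:
  fixes M :: "real^('a::finite + 'b::finite)^('a + 'b)"
  assumes sym: "transpose M = M"
    and pos: "\<And>u. u \<noteq> 0 \<Longrightarrow> 0 < join_vec u 0 \<bullet> (M *v join_vec u 0)"
  shows "pos_def (block11 M)"
  unfolding pos_def_def
proof (intro conjI allI impI)
  have "M $ a $ b = M $ b $ a" for a b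
    using arg_cong[OF sym, of "\<lambda>A. A $ b $ a"] by (simp add: transpose_def)
  then show "transpose (block11 M) = block11 M"
    by (simp add: block11_def transpose_def vec_eq_iff)
next
  fix u :: "real^'a" assume "u \<noteq> 0"
  then show "0 < u \<bullet> (block11 M *v u)"
    using pos[of u] by (simp add: matrix_vector_mult_join_vec[OF sym] inner_join_vec)
qed

text \<open>Lets the hypothesis that Y_1 meets im(X) trivially be applied to the vectors that test
  \<open>block11 M\<close>.\<close>

lemma join_vec_in_span:
  "join_vec u (0::real^'b::finite) \<in> span (range (\<lambda>i::'a::finite. axis (Inl i) 1))"
proof -
  have "join_vec u (0::real^'b) = (\<Sum>i\<in>UNIV. u $ i *\<^sub>R axis (Inl i) 1)"
    by (auto simp: vec_eq_iff join_vec_def axis_def if_distrib cong: if_cong split: sum.split)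
  then show ?thesis
    by (simp only:) (intro span_sum span_scale span_base rangeI)
qed

subsection \<open>Gaussian integrals\<close>

lemma prod_Basis_cart:
  fixes f :: "real^'n \<Rightarrow> 'a::comm_monoid_mult"
  shows "prod f Basis = (\<Prod>i\<in>UNIV. f (axis i 1))"
proof -
  have "inj (\<lambda>i::'n. axis i (1::real))"
    by (simp add: inj_on_def axis_eq_axis)
  then have "prod f (range (\<lambda>i::'n. axis i 1)) = (\<Prod>i\<in>UNIV. f (axis i 1))"
    by (simp add: prod.reindex)
  moreover have "range (\<lambda>i::'n. axis i 1) = (Basis :: (real^'n) set)"
    by (auto simp: Basis_vec_def)
  ultimately show ?thesis
    by simp
qed

text \<open>Fubini with coordinate \<open>m\<close> innermost: as \<open>m\<close> differs from
  \<open>n\<close>, the added multiple of \<open>x $ n\<close> is constant there, and the inner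
  integral is translation invariant.\<close>

lemma nn_integral_lborel_shear:
  fixes m n :: "'n::finite"
  assumes "m \<noteq> n" and [measurable]: "g \<in> borel_measurable borel"
  shows "(\<integral>\<^sup>+x. g (x + (c * x $ n) *\<^sub>R axis m 1) \<partial>lborel) = (\<integral>\<^sup>+x. g x \<partial>(lborel :: (real^'n) measure))"
proof -
  let ?e = "axis m 1 :: real^'n" and ?B = "Basis :: (real^'n) set"
  \<comment> \<open>\<open>J\<close> assembles a vector from its coordinates, and \<open>J'\<close>
    does so with coordinate \<open>m\<close> set to zero.\<close>
  define J where "J f = (\<Sum>b\<in>?B. f b *\<^sub>R b)" for f
  define J' where "J' f = (\<Sum>b\<in>?B - {?e}. f b *\<^sub>R b)" for f
  interpret product_sigma_finite "\<lambda>_::real^'n. lborel :: real measure"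
    by standard
  have B: "?B = insert ?e (?B - {?e})" and fin: "finite (?B - {?e})"
    by (auto simp: Basis_vec_def)
  have J_upd: "J (f(?e := y)) = J' f + y *\<^sub>R ?e" for f y
  proof -
    have "J h = h ?e *\<^sub>R ?e + J' h" for h
      unfolding J_def J'_def by (rule sum.remove) (auto simp: Basis_vec_def)
    then show ?thesis by (simp add: J'_def add.commute)
  qed
  have J_n: "J (f(?e := y)) $ n = J' f $ n" for f y
    unfolding J_upd using assms(1) by (simp add: axis_def)
  have J_meas [measurable]: "J \<in> borel_measurable (\<Pi>\<^sub>M b\<in>?B. lborel)"
    unfolding J_def by measurable
  have upd: "(\<integral>\<^sup>+x. h x \<partial>lborel) =
      (\<integral>\<^sup>+f. (\<integral>\<^sup>+y. h (J (f(?e := y))) \<partial>lborel) \<partial>(\<Pi>\<^sub>M b\<in>?B - {?e}. lborel))"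
    if [measurable]: "h \<in> borel_measurable borel" for h :: "real^'n \<Rightarrow> ennreal"
  proof -
    have "(\<integral>\<^sup>+x. h x \<partial>lborel) = (\<integral>\<^sup>+f. h (J f) \<partial>(\<Pi>\<^sub>M b\<in>?B. lborel))"
      unfolding J_def[abs_def] by (subst lborel_eq) (subst nn_integral_distr; simp)
    also have "\<dots> = (\<integral>\<^sup>+f. h (J f) \<partial>(\<Pi>\<^sub>M b\<in>insert ?e (?B - {?e}). lborel))"
      by (simp only: B[symmetric])
    also have "\<dots> = (\<integral>\<^sup>+f. (\<integral>\<^sup>+y. h (J (f(?e := y))) \<partial>lborel) \<partial>(\<Pi>\<^sub>M b\<in>?B - {?e}. lborel))"
      by (rule product_nn_integral_insert[OF fin]) (simp_all only: B[symmetric], measurable)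
    finally show ?thesis .
  qed
  have inner: "(\<integral>\<^sup>+y. g (J (f(?e := y)) + (c * J (f(?e := y)) $ n) *\<^sub>R ?e) \<partial>lborel) =
      (\<integral>\<^sup>+y. g (J (f(?e := y))) \<partial>lborel)" for f
  proof -
    have "(\<integral>\<^sup>+y. g (J (f(?e := y))) \<partial>lborel) = (\<integral>\<^sup>+y. g (J' f + y *\<^sub>R ?e) \<partial>lborel)"
      by (simp add: J_upd)
    also have "\<dots> = (\<integral>\<^sup>+y. g (J' f + (c * J' f $ n + 1 * y) *\<^sub>R ?e) \<partial>lborel)"
      by (subst nn_integral_real_affine[where c=1 and t="c * J' f $ n"]) auto
    also have "\<dots> = (\<integral>\<^sup>+y. g (J (f(?e := y)) + (c * J (f(?e := y)) $ n) *\<^sub>R ?e) \<partial>lborel)"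
      unfolding J_n by (simp add: J_upd algebra_simps)
    finally show ?thesis by simp
  qed
  show ?thesis
    using upd[of g] upd[of "\<lambda>x. g (x + (c * x $ n) *\<^sub>R ?e)"] by (simp add: inner)
qed

text \<open>Swapping coordinates permutes the side lengths of a box and so keeps its volume;
  Lebesgue measure is determined by its values on boxes.\<close>

lemma nn_integral_lborel_swap:
  fixes m n :: "'n::finite"
  assumes [measurable]: "g \<in> borel_measurable borel"
  shows "(\<integral>\<^sup>+x. g (\<chi> i. x $ Transposition.transpose m n i) \<partial>lborel) =
    (\<integral>\<^sup>+x. g x \<partial>(lborel :: (real^'n) measure))"
proof -
  let ?p = "Transposition.transpose m n"
  let ?T = "\<lambda>x::real^'n. \<chi> i. x $ ?p i"
  have [measurable]: "?T \<in> borel_measurable borel"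
    by (intro borel_measurable_continuous_onI continuous_intros)
  have "lborel = distr lborel borel ?T"
  proof (rule lborel_eqI)
    fix l u :: "real^'n"
    assume le: "\<And>b. b \<in> Basis \<Longrightarrow> l \<bullet> b \<le> u \<bullet> b"
    have le': "l $ i \<le> u $ i" for i
      using le[of "axis i 1"] by (simp add: inner_axis)
    have vim: "?T -` box l u = box (?T l) (?T u)"
      by (auto simp: mem_box_cart) (metis transpose_involutory)+
    have "emeasure (distr lborel borel ?T) (box l u) = emeasure lborel (box (?T l) (?T u))"
      by (simp add: emeasure_distr vim)
    also have "\<dots> = (\<Prod>b\<in>Basis. (?T u - ?T l) \<bullet> b)"
      using le' by (intro emeasure_lborel_box) (auto simp: Basis_vec_def inner_axis)
    also have "(\<Prod>b\<in>Basis. (?T u - ?T l) \<bullet> b) = (\<Prod>i\<in>UNIV. (\<lambda>i. u $ i - l $ i) (?p i))"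
      by (simp add: prod_Basis_cart inner_axis)
    also have "\<dots> = (\<Prod>i\<in>UNIV. u $ i - l $ i)"
      by (rule prod.reindex_bij_betw) (simp add: bij_def)
    also have "\<dots> = (\<Prod>b\<in>Basis. (u - l) \<bullet> b)"
      by (simp add: prod_Basis_cart inner_axis)
    finally show "emeasure (distr lborel borel ?T) (box l u) = (\<Prod>b\<in>Basis. (u - l) \<bullet> b)" .
  qed simp
  then have "(\<integral>\<^sup>+x. g x \<partial>lborel) = (\<integral>\<^sup>+x. g x \<partial>distr lborel borel ?T)"
    by simp
  then show ?thesis
    by (simp add: nn_integral_distr)
qed

text \<open>A diagonal matrix rescales each axis separately, so the density factor is the product of
  the absolute diagonal entries.\<close>

lemma nn_integral_lborel_diagonal:
  fixes A :: "real^'n^'n"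
  assumes diag: "\<And>i j. i \<noteq> j \<Longrightarrow> A $ i $ j = 0" and "det A \<noteq> 0"
    and [measurable]: "g \<in> borel_measurable borel"
  shows "ennreal \<bar>det A\<bar> * (\<integral>\<^sup>+x. g (A *v x) \<partial>lborel) = (\<integral>\<^sup>+x. g x \<partial>lborel)"
proof -
  have det: "det A = (\<Prod>i\<in>UNIV. A $ i $ i)"
    by (rule det_diagonal) (rule diag)
  \<comment> \<open>Reads off the diagonal entry through the basis vector, since the scaling rule is
    indexed by \<open>Basis\<close>.\<close>
  define c where "c b = b \<bullet> (A *v b)" for b :: "real^'n"
  have c: "c (axis i 1) = A $ i $ i" for i
    by (simp add: c_def matrix_vector_mult_basis inner_axis' column_def)
  have "c b \<noteq> 0" if "b \<in> Basis" for b
    using that \<open>det A \<noteq> 0\<close> by (auto simp: Basis_vec_def c det)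
  note affine = lborel_affine_euclidean[of c 0, OF this]
  have "0 + (\<Sum>b\<in>Basis. (c b * (x \<bullet> b)) *\<^sub>R b) = A *v x" for x
  proof -
    have "(\<Sum>b\<in>Basis. (c b * (x \<bullet> b)) *\<^sub>R b) \<bullet> b' = (A *v x) \<bullet> b'" if "b' \<in> Basis" for b'
    proof -
      obtain i where b': "b' = axis i 1"
        using \<open>b' \<in> Basis\<close> by (auto simp: Basis_vec_def)
      have "(A *v x) \<bullet> b' = (\<Sum>j\<in>UNIV. if j = i then A $ i $ i * x $ i else 0)"
        unfolding b' inner_axis matrix_vector_mult_def vec_lambda_beta inner_real_def mult_1_right
        by (intro sum.cong) (auto simp: diag)
      then show ?thesis
        using that by (simp add: inner_sum_left_Basis) (simp add: b' c inner_axis)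
    qed
    then show ?thesis
      by (auto intro: euclidean_eqI)
  qed
  then have eq: "lborel = density (distr lborel borel ((*v) A)) (\<lambda>_. ennreal \<bar>det A\<bar>)"
    using affine by (simp add: det prod_Basis_cart c abs_prod)
  have [measurable]: "(*v) A \<in> borel_measurable borel"
    by (intro borel_measurable_continuous_onI linear_continuous_on) simp
  have "(\<integral>\<^sup>+x. g x \<partial>lborel) = (\<integral>\<^sup>+x. g x \<partial>density (distr lborel borel ((*v) A)) (\<lambda>_. ennreal \<bar>det A\<bar>))"
    using eq by simp
  also have "\<dots> = ennreal \<bar>det A\<bar> * (\<integral>\<^sup>+x. g (A *v x) \<partial>lborel)"
    by (simp add: nn_integral_density nn_integral_distr nn_integral_cmult)
  finally show ?thesis by simp
qed

text \<open>The library's linear change of variables needs a well-ordered index type.\<close>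
lemma nn_integral_lborel_matrix:
  fixes A :: "real^'n^'n"
  assumes "det A \<noteq> 0" "g \<in> borel_measurable borel"
  shows "ennreal \<bar>det A\<bar> * (\<integral>\<^sup>+x. g (A *v x) \<partial>lborel) = (\<integral>\<^sup>+x. g x \<partial>lborel)"
proof -
  \<comment> \<open>\<open>g\<close> is quantified inside the induction because the product case
    applies the hypothesis for \<open>B\<close> to \<open>g\<close> composed with
    \<open>A\<close>.\<close>
  have "\<forall>g. det A \<noteq> 0 \<longrightarrow> g \<in> borel_measurable borel \<longrightarrow>
    ennreal \<bar>det A\<bar> * (\<integral>\<^sup>+x. g (A *v x) \<partial>lborel) = (\<integral>\<^sup>+x. g x \<partial>lborel)" (is "?P A")
  proof (induction A rule: induct_matrix_elementary)
    case (1 A B)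
    show ?case
    proof (intro allI impI)
      fix g :: "real^'n \<Rightarrow> ennreal"
      assume det: "det (A ** B) \<noteq> 0" and g: "g \<in> borel_measurable borel"
      have [measurable]: "(*v) A \<in> borel_measurable borel"
        by (intro borel_measurable_continuous_onI linear_continuous_on) simp
      have gA: "(\<lambda>x. g (A *v x)) \<in> borel_measurable borel"
        using g by measurable
      have "ennreal \<bar>det (A ** B)\<bar> * (\<integral>\<^sup>+x. g (A ** B *v x) \<partial>lborel) =
          ennreal \<bar>det A\<bar> * (ennreal \<bar>det B\<bar> * (\<integral>\<^sup>+x. g (A *v (B *v x)) \<partial>lborel))"
        by (simp add: det_mul abs_mult ennreal_mult matrix_vector_mul_assoc mult.assoc)
      also have "\<dots> = ennreal \<bar>det A\<bar> * (\<integral>\<^sup>+x. g (A *v x) \<partial>lborel)"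
        using "1"(2)[rule_format, OF _ gA] det by (simp add: det_mul)
      also have "\<dots> = (\<integral>\<^sup>+x. g x \<partial>lborel)"
        using "1"(1) g det by (simp add: det_mul)
      finally show "ennreal \<bar>det (A ** B)\<bar> * (\<integral>\<^sup>+x. g (A ** B *v x) \<partial>lborel) = (\<integral>\<^sup>+x. g x \<partial>lborel)" .
    qed
  next
    case (2 A i)
    \<comment> \<open>Vacuous: a zero row makes the determinant vanish.\<close>
    then show ?case by (simp add: det_zero_row)
  next
    case (3 A)
    then show ?case using nn_integral_lborel_diagonal by blast
  next
    case (4 m n)
    let ?p = "Transposition.transpose m n"
    let ?A = "\<chi> i j. mat 1 $ i $ ?p j :: real^'n^'n"
    have "\<bar>det ?A\<bar> = 1"
      by (simp add: det_permute_columns permutes_swap_id sign_swap_id abs_mult)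
    moreover have "?A *v x = (\<chi> i. x $ ?p i)" for x
    proof -
      have "(\<Sum>j\<in>UNIV. (if i = ?p j then 1 else 0) * x $ j) =
          (\<Sum>j\<in>UNIV. if j = ?p i then x $ j else 0)" for i
        by (intro sum.cong) (auto simp: transpose_involutory)
      then show ?thesis
        by (simp add: matrix_vector_mult_def mat_def vec_eq_iff)
    qed
    ultimately show ?case
      by (simp add: nn_integral_lborel_swap)
  next
    case (5 m n c)
    let ?A = "\<chi> i j. if i = m \<and> j = n then c else of_bool (i = j) :: real^'n^'n"
    \<comment> \<open>Seen as a row operation on the identity, the shear has determinant
      one.\<close>
    have A: "?A = (\<chi> k. if k = m then row m (mat 1) + c *s row n (mat 1) else row k (mat 1))"
      using "5" by (auto simp: vec_eq_iff row_def mat_def)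
    have "det ?A = 1"
      unfolding A by (subst det_row_operation[OF "5"]) simp
    moreover have "?A *v x = x + (c * x $ n) *\<^sub>R axis m 1" for x
    proof -
      have "(\<Sum>j\<in>UNIV. (if i = m \<and> j = n then c else of_bool (i = j)) * x $ j) =
          (\<Sum>j\<in>UNIV. (if j = i then x $ j else 0) + (if j = n then (if i = m then c * x $ n else 0) else 0))" for i
        using "5" by (intro sum.cong) auto
      then show ?thesis
        by (simp add: matrix_vector_mult_def vec_eq_iff sum.distrib axis_def)
    qed
    ultimately show ?case
      using nn_integral_lborel_shear[OF "5"] by simp
  qed
  with assms show ?thesis by blast
qed

section \<open>Normalizing constants of Gaussian densities\<close>

text \<open>The integrand factors over the basis directions, and each factor is
  \<open>sqrt (2 * pi)\<close> times the standard normal density, which has mass one.\<close>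

lemma nn_integral_gaussian_standard:
  "(\<integral>\<^sup>+x. ennreal (exp (- (1/2) * (x \<bullet> x))) \<partial>(lborel :: 'a::euclidean_space measure)) =
    ennreal (sqrt (2 * pi) ^ DIM('a))"
proof -
  have one: "(\<integral>\<^sup>+t. ennreal (exp (- (1/2) * t\<^sup>2)) \<partial>lborel) = ennreal (sqrt (2 * pi))"
  proof -
    have "(\<integral>\<^sup>+t. ennreal (exp (- (1/2) * t\<^sup>2)) \<partial>lborel) =
        (\<integral>\<^sup>+t. ennreal (sqrt (2 * pi)) * ennreal (std_normal_density t) \<partial>lborel)"
      by (intro nn_integral_cong) (simp add: std_normal_density_def ennreal_mult[symmetric])
    also have "\<dots> = ennreal (sqrt (2 * pi)) * (\<integral>\<^sup>+t. ennreal (std_normal_density t) \<partial>lborel)"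
      by (rule nn_integral_cmult) simp
    also have "(\<integral>\<^sup>+t. ennreal (std_normal_density t) \<partial>lborel) = 1"
      by (subst nn_integral_eq_integral) (auto simp: integral_normal_density)
    finally show ?thesis by simp
  qed
  have "ennreal (exp (- (1/2) * (x \<bullet> x))) = (\<Prod>b\<in>Basis. ennreal (exp (- (1/2) * (x \<bullet> b)\<^sup>2)))" for x :: 'a
  proof -
    have "exp (- (1/2) * (x \<bullet> x)) = (\<Prod>b\<in>Basis. exp (- (1/2) * (x \<bullet> b)\<^sup>2))"
      by (subst euclidean_inner)
        (simp add: exp_sum[symmetric] sum_distrib_left sum_divide_distrib sum_negf power2_eq_square)
    then show ?thesis by (simp add: prod_ennreal)
  qed
  then have "(\<integral>\<^sup>+x. ennreal (exp (- (1/2) * (x \<bullet> x))) \<partial>(lborel :: 'a measure)) =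
      (\<integral>\<^sup>+x. (\<Prod>b\<in>Basis. ennreal (exp (- (1/2) * (x \<bullet> b)\<^sup>2))) \<partial>(lborel :: 'a measure))"
    by presburger
  also have "\<dots> = (\<Prod>b\<in>(Basis :: 'a set). \<integral>\<^sup>+t. ennreal (exp (- (1/2) * t\<^sup>2)) \<partial>lborel)"
    by (rule nn_integral_lborel_prod) auto
  also have "\<dots> = ennreal (sqrt (2 * pi) ^ DIM('a))"
    unfolding one by (simp add: ennreal_power)
  finally show ?thesis .
qed

text \<open>Substituting \<open>z = \<mu> + V *v x\<close> gives the standard Gaussian, at the cost
  of the factor \<open>\<bar>det V\<bar>\<close>.\<close>

lemma gaussian_integral:
  fixes Q :: "real^'n^'n"
  assumes "pos_def Q"
  shows "0 < det Q"
    and "(LINT z|lborel. exp (- (1/2) * ((z - \<mu>) \<bullet> (Q *v (z - \<mu>))))) = sqrt ((2 * pi) ^ CARD('n) / det Q)"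
proof -
  obtain V :: "real^'n^'n" where V: "transpose V ** Q ** V = mat 1"
    using assms by (rule pos_def_diagonalization)
  \<comment> \<open>Taking determinants in V* Q V = 1 gives both the sign of \<open>det Q\<close>
    and the value of \<open>\<bar>det V\<bar>\<close>.\<close>
  have dets: "(det V)\<^sup>2 * det Q = 1"
    using arg_cong[OF V, of det] by (simp add: det_mul power2_eq_square mult_ac)
  then have "det V \<noteq> 0" by auto
  then have "0 < (det V)\<^sup>2" by simp
  then show detQ: "0 < det Q"
    using dets by (metis zero_less_mult_pos zero_less_one)
  have "\<bar>det V\<bar> = 1 / sqrt (det Q)"
  proof -
    have "(det V)\<^sup>2 = 1 / det Q"
      using dets detQ by (simp add: field_simps)
    then show ?thesis
      by (metis real_sqrt_abs real_sqrt_divide real_sqrt_one)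
  qed
  then have const: "\<bar>det V\<bar> * sqrt (2 * pi) ^ CARD('n) = sqrt ((2 * pi) ^ CARD('n) / det Q)"
    by (simp only: real_sqrt_divide real_sqrt_power) simp
  define g where "g z = ennreal (exp (- (1/2) * (z \<bullet> (Q *v z))))" for z
  have [measurable]: "(*v) Q \<in> borel_measurable borel"
    by (intro borel_measurable_continuous_onI linear_continuous_on) simp
  have g [measurable]: "g \<in> borel_measurable borel"
    unfolding g_def by measurable
  have gV: "g (V *v x) = ennreal (exp (- (1/2) * (x \<bullet> x)))" for x
  proof -
    have "x \<bullet> ((transpose V ** Q ** V) *v x) = (V *v x) \<bullet> (Q *v (V *v x))"
      using inner_matrix_transpose[of x "transpose V" "Q *v (V *v x)"]
      by (simp only: matrix_vector_mul_assoc matrix_mul_assoc transpose_transpose)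
    then show ?thesis by (simp add: g_def V)
  qed
  have "(\<integral>\<^sup>+z. g (z - \<mu>) \<partial>lborel) = (\<integral>\<^sup>+z. g (z - \<mu>) \<partial>distr lborel borel ((+) \<mu>))"
    by (simp add: lborel_distr_plus)
  also have "\<dots> = (\<integral>\<^sup>+z. g z \<partial>lborel)"
    by (subst nn_integral_distr) auto
  also have "\<dots> = ennreal \<bar>det V\<bar> * (\<integral>\<^sup>+x. g (V *v x) \<partial>lborel)"
    using nn_integral_lborel_matrix[OF \<open>det V \<noteq> 0\<close> g] by simp
  also have "\<dots> = ennreal (sqrt ((2 * pi) ^ CARD('n) / det Q))"
    unfolding gV nn_integral_gaussian_standard
    by (simp add: ennreal_mult[symmetric] const)
  finally have "(\<integral>\<^sup>+z. g (z - \<mu>) \<partial>lborel) = ennreal (sqrt ((2 * pi) ^ CARD('n) / det Q))" .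
  moreover have "(\<lambda>z. exp (- (1/2) * ((z - \<mu>) \<bullet> (Q *v (z - \<mu>))))) \<in> borel_measurable lborel"
    by measurable
  ultimately show "(LINT z|lborel. exp (- (1/2) * ((z - \<mu>) \<bullet> (Q *v (z - \<mu>))))) =
      sqrt ((2 * pi) ^ CARD('n) / det Q)"
    using detQ by (subst integral_eq_nn_integral) (auto simp: g_def)
qed

text \<open>\<open>mvn_density\<close> expects a covariance, so a precision matrix \<open>Q\<close>
  is inverted twice in the exponent and its determinant once.\<close>

lemma mvn_density_matrix_inv:
  fixes Q :: "real^'n^'n"
  assumes "invertible Q"
  shows "mvn_density \<mu> (matrix_inv Q) z =
    exp (- (1/2) * ((z - \<mu>) \<bullet> (Q *v (z - \<mu>)))) / sqrt ((2 * pi) ^ CARD('n) / det Q)"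
proof -
  have "det (matrix_inv Q) * det Q = 1"
    using arg_cong[OF matrix_inv_invertible(2)[OF assms], of det] by (simp add: det_mul)
  then have "det (matrix_inv Q) = 1 / det Q"
    by (metis mult_zero_right nonzero_eq_divide_eq zero_neq_one)
  then show ?thesis
    by (simp add: mvn_density_def matrix_inv_unique_right[OF matrix_inv_invertible(2)[OF assms]])
qed

subsection \<open>Conditional and marginal densities\<close>

theorem mainTheorem9:
  fixes \<Sigma> M :: "real^('n1::finite + 'n2::finite)^('n1 + 'n2)"
    and X :: "real^('p::finite)^('n1 + 'n2)"
    and p :: "real^('n1 + 'n2) \<Rightarrow> real"
    and M11 :: "real^'n1^'n1" and M12 :: "real^'n2^'n1" and M22 :: "real^'n2^'n2"
  assumes "pos_def \<Sigma>"
    and "rank X = CARD('p)"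
    and "M = matrix_inv \<Sigma> - matrix_inv \<Sigma> ** X **
               matrix_inv (transpose X ** matrix_inv \<Sigma> ** X) ** transpose X ** matrix_inv \<Sigma>"
    and "proportional p (\<lambda>y. exp (- (1/2) * (y \<bullet> (M *v y))))"
    and "M11 = block11 M" and "M12 = block12 M" and "M22 = block22 M"
    and "span (range (\<lambda>i::'n1. axis (Inl i) 1)) \<inter> range (\<lambda>b. X *v b) = {0}"
  shows "(\<forall>y2. normal_canonical (conditional_density p y2) (- (M12 *v y2)) M11) \<and>
         improper_normal_canonical (marginal_density p) 0
           (M22 - transpose M12 ** pseudo_inverse M11 ** M12)"
proof -
  interpret gls_precision \<Sigma> M X
    using assms(1-3) by unfold_locales (simp_all add: full_rank_injective)
  \<comment> \<open>A nonzero vector of Y_1 lies outside im(X), where the form of \<open>M\<close>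
    is positive.\<close>
  have Q: "pos_def M11"
    unfolding assms(5)
  proof (rule pos_def_block11[OF symmetric])
    fix u :: "real^'n1" assume "u \<noteq> 0"
    then have "join_vec u (0 :: real^'n2) \<noteq> 0"
      using inner_join_vec[of u "0 :: real^'n2" u 0] by auto
    then have "join_vec u 0 \<notin> range ((*v) X)"
      using join_vec_in_span[of u, where ?'b = 'n2] assms(8) by blast
    then show "0 < join_vec u 0 \<bullet> (M *v join_vec u 0)"
      by (rule quadratic_form_pos)
  qed
  note inv = pos_def_invertible[OF Q]
  define R where "R = matrix_inv M11"
  define S where "S = M22 - transpose M12 ** R ** M12"
  \<comment> \<open>\<open>\<mu> v\<close> is the conditional mean, \<open>G v\<close> the
    unnormalized Gaussian around it, \<open>K\<close> the mass of \<open>G v\<close>, and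
    \<open>E\<close> the factor that depends on \<open>v\<close> alone.\<close>
  define \<mu> where "\<mu> v = - (R *v (M12 *v v))" for v
  define G where "G v u = exp (- (1/2) * ((u - \<mu> v) \<bullet> (M11 *v (u - \<mu> v))))" for v u
  define K where "K = sqrt ((2 * pi) ^ CARD('n1) / det M11)"
  define E where "E v = exp (- (1/2) * (v \<bullet> (S *v v)))" for v
  have square: "join_vec u v \<bullet> (M *v join_vec u v) =
      (u - \<mu> v) \<bullet> (M11 *v (u - \<mu> v)) + v \<bullet> (S *v v)" for u v
    using quadratic_form_complete_square[OF symmetric, of u v] Q
    by (simp add: \<mu>_def S_def R_def assms(5-7))
  obtain c where "c > 0" and "\<And>y. p y = c * exp (- (1/2) * (y \<bullet> (M *v y)))"
    using assms(4) by (auto simp: proportional_def)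
  then have p: "p (join_vec u v) = c * E v * G v u" for u v
    by (simp add: square E_def G_def exp_add[symmetric] add_divide_distrib)
  have "0 < K"
    using gaussian_integral(1)[OF Q] by (simp add: K_def)
  \<comment> \<open>The value is positive, so it is not the default 0 of a divergent integral, and
    it may serve as the denominator of the conditional density.\<close>
  have integral_p: "(LINT u|lborel. p (join_vec u v)) = c * E v * K" for v
    unfolding p integral_mult_right_zero G_def gaussian_integral(2)[OF Q] K_def ..
  have "normal_canonical (conditional_density p v) (- (M12 *v v)) M11" for v
    unfolding normal_canonical_def
  proof (intro conjI exI)
    show "- (M12 *v v) = M11 *v \<mu> v"
      unfolding \<mu>_def R_def linear_neg[OF matrix_vector_mul_linear] matrix_vector_mul_assoc
        matrix_mul_assoc matrix_inv_invertible(1)[OF inv] matrix_mul_lid ..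
    show "conditional_density p v = mvn_density (\<mu> v) (matrix_inv M11)"
    proof
      fix u
      \<comment> \<open>The unknown constant \<open>c\<close> and the factor \<open>E v\<close>
        cancel.\<close>
      have "conditional_density p v u = G v u / K"
        unfolding conditional_density_def integral_p
        unfolding p using \<open>c > 0\<close> \<open>0 < K\<close> by (simp add: E_def)
      then show "conditional_density p v u = mvn_density (\<mu> v) (matrix_inv M11) u"
        by (simp add: mvn_density_matrix_inv[OF inv] G_def K_def)
    qed
  qed (rule Q)
  moreover have "improper_normal_canonical (marginal_density p) 0 S"
    unfolding improper_normal_canonical_def
  proof (intro conjI refl)
    have "M $ a $ b = M $ b $ a" for a b
      using arg_cong[OF symmetric, of "\<lambda>A. A $ b $ a"] by (simp add: transpose_def)
    then have "transpose M22 = M22"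
      by (simp add: assms(7) block22_def transpose_def vec_eq_iff)
    moreover have "transpose R = R"
      using pos_def_matrix_inv[OF Q] by (simp add: R_def pos_def_def)
    moreover have "transpose (A - B) = transpose A - transpose B" for A B :: "real^'n2^'n2"
      by (simp add: transpose_def vec_eq_iff)
    ultimately have "transpose S = S"
      by (simp add: S_def matrix_transpose_mul matrix_mul_assoc)
    \<comment> \<open>At the first block \<open>\<mu> v\<close> the completed square vanishes, so
      the form of \<open>S\<close> at \<open>v\<close> is a value of the form of
      \<open>M\<close>.\<close>
    moreover have "0 \<le> v \<bullet> (S *v v)" for v
      using quadratic_form_nonneg[of "join_vec (\<mu> v) v"] by (simp add: square)
    ultimately show "pos_semidef S"
      by (simp add: pos_semidef_def)
    have "marginal_density p v = (c * K) * E v" for v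
      unfolding marginal_density_def integral_p by simp
    then show "proportional (marginal_density p) (\<lambda>z. exp (- (1/2) * (z \<bullet> (S *v z))))"
      using \<open>c > 0\<close> \<open>0 < K\<close> unfolding proportional_def E_def
      by (intro exI[of _ "c * K"]) simp
  qed
  ultimately show ?thesis
    by (simp add: S_def R_def pseudo_inverse_invertible[OF inv])
qed

end
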